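(* Let $p$ be a prime and let $c$ be a positive integer. Then there exists a capable $p$-group $G$ of nilpotency class exactly $c$ that is minimally generated by two elements, one of order $p$ and the other of order $p^{1+\lfloor\frac{c-1}{p-1}\rfloor}$.
   Context: A group $G$ is called capable if there exists a group $K$ such that $G\cong K/Z(K)$, where $Z(K)$ is the center of $K$. The lower central series of $G$ is defined by $G_1=G$ and $G_{n+1}=[G_n,G]$; $G$ has class exactly $c$ if $G_{c+1}$ is trivial and $G_c$ is nontrivial. A group is minimally generated by a set of elements if that set generates the group and no proper subset of it does. $\lfloor x\rfloor$ denotes the greatest integer less than or equal to $x$. *)

theory Defs
  imports "HOL-Algebra.Generated_Groups" "HOL-Algebra.Multiplicative_Group"
    "HOL-Computational_Algebra.Primes"
begin

definition center :: "('a, 'm) monoid_scheme \<Rightarrow> 'a set"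
  where "center G = {z \<in> carrier G. \<forall>x \<in> carrier G. z \<otimes>\<^bsub>G\<^esub> x = x \<otimes>\<^bsub>G\<^esub> z}"

text \<open>HOL cannot quantify over all types, so the witness lives on the type \<open>'a list\<close>, where \<open>'a\<close>
  is the element type of \<open>G\<close>. Nothing is lost: lemma \<open>capableI\<close> below admits a witness of
  arbitrary type.\<close>

definition capable :: "('a, 'm) monoid_scheme \<Rightarrow> bool"
  where "capable G \<longleftrightarrow> (\<exists>K :: 'a list monoid. group K \<and> G \<cong> K Mod center K)"

definition commutator_subgroup :: "('a, 'm) monoid_scheme \<Rightarrow> 'a set \<Rightarrow> 'a set \<Rightarrow> 'a set"
  where "commutator_subgroup G A B =
    generate G {inv\<^bsub>G\<^esub> a \<otimes>\<^bsub>G\<^esub> inv\<^bsub>G\<^esub> b \<otimes>\<^bsub>G\<^esub> a \<otimes>\<^bsub>G\<^esub> b | a b. a \<in> A \<and> b \<in> B}"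

text \<open>The series is indexed from 1; the value at 0 is a dummy.\<close>

fun lower_central :: "('a, 'm) monoid_scheme \<Rightarrow> nat \<Rightarrow> 'a set"
  where
    "lower_central G 0 = carrier G"
  | "lower_central G (Suc 0) = carrier G"
  | "lower_central G (Suc (Suc n)) =
      commutator_subgroup G (lower_central G (Suc n)) (carrier G)"

definition class_exactly :: "('a, 'm) monoid_scheme \<Rightarrow> nat \<Rightarrow> bool"
  where "class_exactly G c \<longleftrightarrow>
    lower_central G (c + 1) = {\<one>\<^bsub>G\<^esub>} \<and> lower_central G c \<noteq> {\<one>\<^bsub>G\<^esub>}"

definition p_group :: "nat \<Rightarrow> ('a, 'm) monoid_scheme \<Rightarrow> bool"
  where "p_group p G \<longleftrightarrow> group G \<and> (\<forall>x \<in> carrier G. \<exists>k. group.ord G x = p ^ k)"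

definition minimally_generated_by :: "('a, 'm) monoid_scheme \<Rightarrow> 'a set \<Rightarrow> bool"
  where "minimally_generated_by G S \<longleftrightarrow>
    S \<subseteq> carrier G \<and> generate G S = carrier G \<and> (\<forall>T. T \<subset> S \<longrightarrow> generate G T \<noteq> carrier G)"


text \<open>Independence of \<open>capable\<close> from the type of the witness: lifting the elements of \<open>G\<close> to
  \<open>K\<close> generates a subgroup with the same central quotient, small enough to be coded by lists
  over \<open>G\<close>.\<close>

lemma capableI:
  fixes G :: "('a, 'm) monoid_scheme" and K :: "('k, 'n) monoid_scheme"
  assumes G: "group G" and K: "group K" and iso: "G \<cong> K Mod center K"
  shows "capable G"
proof -
  interpret G: group G by (rule G)
  interpret K: group K by (rule K)
  have comm: "z \<otimes>\<^bsub>K\<^esub> x = x \<otimes>\<^bsub>K\<^esub> z" if "z \<in> center K" "x \<in> carrier K" for z x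
    using that unfolding center_def by blast
  have Zc: "center K \<subseteq> carrier K" unfolding center_def by blast
  have Zsub: "subgroup (center K) K"
  proof (rule K.subgroupI)
    show "center K \<subseteq> carrier K" by (rule Zc)
    have "\<one>\<^bsub>K\<^esub> \<in> center K" by (simp add: center_def)
    then show "center K \<noteq> {}" by blast
  next
    fix a assume a: "a \<in> center K"
    then have ac: "a \<in> carrier K" using Zc by blast
    have "inv\<^bsub>K\<^esub> a \<otimes>\<^bsub>K\<^esub> x = x \<otimes>\<^bsub>K\<^esub> inv\<^bsub>K\<^esub> a" if x: "x \<in> carrier K" for x
    proof -
      have "a \<otimes>\<^bsub>K\<^esub> inv\<^bsub>K\<^esub> x = inv\<^bsub>K\<^esub> x \<otimes>\<^bsub>K\<^esub> a"
        using comm[OF a] x by blast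
      then have "inv\<^bsub>K\<^esub> (a \<otimes>\<^bsub>K\<^esub> inv\<^bsub>K\<^esub> x) = inv\<^bsub>K\<^esub> (inv\<^bsub>K\<^esub> x \<otimes>\<^bsub>K\<^esub> a)"
        by (rule arg_cong)
      then show ?thesis using ac x by (simp add: K.inv_mult_group)
    qed
    then show "inv\<^bsub>K\<^esub> a \<in> center K" using ac unfolding center_def by blast
  next
    fix a b assume a: "a \<in> center K" and b: "b \<in> center K"
    then have ab: "a \<in> carrier K" "b \<in> carrier K" using Zc by blast+
    have "a \<otimes>\<^bsub>K\<^esub> b \<otimes>\<^bsub>K\<^esub> x = x \<otimes>\<^bsub>K\<^esub> (a \<otimes>\<^bsub>K\<^esub> b)" if x: "x \<in> carrier K" for x
    proof -
      have "a \<otimes>\<^bsub>K\<^esub> b \<otimes>\<^bsub>K\<^esub> x = a \<otimes>\<^bsub>K\<^esub> (x \<otimes>\<^bsub>K\<^esub> b)"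
        using comm[OF b x] ab x by (simp add: K.m_assoc)
      also have "\<dots> = (x \<otimes>\<^bsub>K\<^esub> a) \<otimes>\<^bsub>K\<^esub> b"
        using comm[OF a x] ab x by (simp add: K.m_assoc[symmetric])
      finally show ?thesis using ab x by (simp add: K.m_assoc)
    qed
    then show "a \<otimes>\<^bsub>K\<^esub> b \<in> center K" using ab unfolding center_def by blast
  qed
  have Znorm: "center K \<lhd> K"
    unfolding K.normal_inv_iff
  proof (intro conjI ballI Zsub)
    fix x h assume x: "x \<in> carrier K" and h: "h \<in> center K"
    then have "x \<otimes>\<^bsub>K\<^esub> h \<otimes>\<^bsub>K\<^esub> inv\<^bsub>K\<^esub> x = h"
      using comm[OF h x] Zc by (metis K.inv_solve_right' K.m_closed subsetD)
    with h show "x \<otimes>\<^bsub>K\<^esub> h \<otimes>\<^bsub>K\<^esub> inv\<^bsub>K\<^esub> x \<in> center K" by simp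
  qed
  interpret Z: normal "center K" K by (rule Znorm)
  interpret Q: group "K Mod center K" by (rule Z.factorgroup_is_group)

  obtain \<psi> where \<psi>: "\<psi> \<in> iso (K Mod center K) G"
    using G.iso_sym[OF iso] by (auto simp: is_iso_def)
  define \<pi> where "\<pi> = \<psi> \<circ> (\<lambda>a. center K #>\<^bsub>K\<^esub> a)"
  have \<pi>hom: "\<pi> \<in> hom K G"
    unfolding \<pi>_def using Z.r_coset_hom_Mod \<psi> by (auto simp: iso_def intro: hom_compose)
  interpret \<pi>: group_hom K G \<pi> by unfold_locales (rule \<pi>hom)
  have \<psi>inj: "inj_on \<psi> (carrier (K Mod center K))" and
    \<psi>img: "\<psi> ` carrier (K Mod center K) = carrier G"
    using \<psi> by (auto simp: iso_def bij_betw_def)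
  have \<pi>img: "\<pi> ` carrier K = carrier G"
    using \<psi>img by (auto simp: \<pi>_def carrier_FactGroup image_image)
  have \<pi>ker: "\<pi> x = \<one>\<^bsub>G\<^esub> \<longleftrightarrow> x \<in> center K" if x: "x \<in> carrier K" for x
  proof -
    have "\<pi> \<one>\<^bsub>K\<^esub> = \<one>\<^bsub>G\<^esub>" by simp
    then have one: "\<psi> (center K #>\<^bsub>K\<^esub> \<one>\<^bsub>K\<^esub>) = \<one>\<^bsub>G\<^esub>" by (simp add: \<pi>_def)
    have "\<pi> x = \<one>\<^bsub>G\<^esub> \<longleftrightarrow> \<psi> (center K #>\<^bsub>K\<^esub> x) = \<psi> (center K #>\<^bsub>K\<^esub> \<one>\<^bsub>K\<^esub>)"
      by (simp add: one) (simp add: \<pi>_def)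
    also have "\<dots> \<longleftrightarrow> center K #>\<^bsub>K\<^esub> x = center K #>\<^bsub>K\<^esub> \<one>\<^bsub>K\<^esub>"
      using x \<psi>inj by (auto simp: carrier_FactGroup inj_on_def)
    also have "\<dots> \<longleftrightarrow> x \<in> center K"
      using K.coset_join1[OF _ x Zsub] K.coset_join2[OF x Zsub] K.coset_mult_one[OF Zc] by auto
    finally show ?thesis .
  qed

  define s where "s = (\<lambda>g. if g = \<one>\<^bsub>G\<^esub> then \<one>\<^bsub>K\<^esub> else (SOME k. k \<in> carrier K \<and> \<pi> k = g))"
  have s: "s g \<in> carrier K \<and> \<pi> (s g) = g" if "g \<in> carrier G" for g
  proof (cases "g = \<one>\<^bsub>G\<^esub>")
    case True then show ?thesis by (simp add: s_def)
  next
    case False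
    have "\<exists>k. k \<in> carrier K \<and> \<pi> k = g" using that \<pi>img by (metis imageE)
    from someI_ex[OF this] False show ?thesis by (simp add: s_def)
  qed
  have s1: "s \<one>\<^bsub>G\<^esub> = \<one>\<^bsub>K\<^esub>" by (simp add: s_def)
  define H where "H = generate K (s ` carrier G)"
  have Hsub: "subgroup H K"
    unfolding H_def by (rule K.generate_is_subgroup) (use s in auto)
  interpret H: subgroup H K by (rule Hsub)

  \<comment> \<open>Reading a list as a product of \<open>s x * (s y)\<^sup>-\<^sup>1\<close> over consecutive pairs reaches all of \<open>H\<close>.\<close>
  define ev where "ev = (\<lambda>ps. foldr (\<lambda>(x, y) r. s x \<otimes>\<^bsub>K\<^esub> inv\<^bsub>K\<^esub> (s y) \<otimes>\<^bsub>K\<^esub> r) ps \<one>\<^bsub>K\<^esub>)"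
  define flat where "flat = (\<lambda>ps. concat (map (\<lambda>(x, y). [x, y]) ps) :: 'a list)"
  have flat_inj: "ps = qs" if "flat ps = flat qs" for ps qs
    using that by (induction ps qs rule: list_induct2') (auto simp: flat_def)
  let ?P = "lists (carrier G \<times> carrier G)"
  have ev_closed: "ev ps \<in> carrier K" if "ps \<in> ?P" for ps
    using that s by (induction ps) (auto simp: ev_def)
  have ev_app: "ev (ps @ qs) = ev ps \<otimes>\<^bsub>K\<^esub> ev qs" if "ps \<in> ?P" "qs \<in> ?P" for ps qs
    using that(1)
  proof (induction ps)
    case Nil
    then show ?case using ev_closed[OF that(2)] by (simp add: ev_def)
  next
    case (Cons a ps)
    obtain x y where a: "a = (x, y)" by (cases a)
    have xy: "x \<in> carrier G" "y \<in> carrier G" "ps \<in> ?P" using Cons a by auto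
    have E: "ev (a # us) = s x \<otimes>\<^bsub>K\<^esub> inv\<^bsub>K\<^esub> (s y) \<otimes>\<^bsub>K\<^esub> ev us" for us by (simp add: ev_def a)
    show ?case
      using xy s[of x] s[of y] ev_closed[OF that(2)] ev_closed[of ps] Cons.IH
      by (simp add: E K.m_assoc)
  qed
  have H_ev: "\<exists>ps \<in> ?P. h = ev ps" if "h \<in> H" for h
    using that unfolding H_def
  proof (induction rule: generate.induct)
    case one then show ?case by (intro bexI[of _ "[]"]) (auto simp: ev_def)
  next
    case (incl h)
    then obtain g where g: "g \<in> carrier G" "h = s g" by auto
    then show ?case using s[of g] s1
      by (intro bexI[of _ "[(g, \<one>\<^bsub>G\<^esub>)]"]) (auto simp: ev_def)
  next
    case (inv h)
    then obtain g where g: "g \<in> carrier G" "h = s g" by auto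
    then show ?case using s[of g] s1
      by (intro bexI[of _ "[(\<one>\<^bsub>G\<^esub>, g)]"]) (auto simp: ev_def)
  next
    case (eng h1 h2)
    then obtain ps qs where "ps \<in> ?P" "qs \<in> ?P" "h1 = ev ps" "h2 = ev qs" by blast
    then show ?case using ev_app by (intro bexI[of _ "ps @ qs"]) auto
  qed
  then obtain code0 where code0: "\<And>h. h \<in> H \<Longrightarrow> h = ev (code0 h)" by metis
  define f where "f = (\<lambda>h. flat (code0 h))"
  have finj: "inj_on f H"
    by (rule inj_onI) (metis f_def flat_inj code0)
  define g where "g = inv_into H f"
  have gf: "g (f h) = h" if "h \<in> H" for h
    using that finj by (simp add: g_def)
  define L :: "'a list monoid"
    where "L = \<lparr>carrier = f ` H, monoid.mult = (\<lambda>u v. f (g u \<otimes>\<^bsub>K\<^esub> g v)), one = f \<one>\<^bsub>K\<^esub>\<rparr>"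
  have Lgrp: "group L"
  proof (rule groupI)
    fix x assume "x \<in> carrier L"
    then obtain h where h: "h \<in> H" "x = f h" by (auto simp: L_def)
    then show "\<exists>y\<in>carrier L. y \<otimes>\<^bsub>L\<^esub> x = \<one>\<^bsub>L\<^esub>"
      by (intro bexI[of _ "f (inv\<^bsub>K\<^esub> h)"]) (auto simp: L_def gf)
  qed (auto simp: L_def gf K.m_assoc)
  interpret L: group L by (rule Lgrp)
  define \<rho> where "\<rho> = \<pi> \<circ> g"
  have \<rho>hom: "\<rho> \<in> hom L G"
    by (rule homI) (auto simp: \<rho>_def L_def gf)
  interpret \<rho>: group_hom L G \<rho> by unfold_locales (rule \<rho>hom)
  have \<rho>img: "\<rho> ` carrier L = carrier G"
  proof
    show "\<rho> ` carrier L \<subseteq> carrier G" by auto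
    show "carrier G \<subseteq> \<rho> ` carrier L"
    proof
      fix x assume x: "x \<in> carrier G"
      have "s x \<in> H" unfolding H_def using x by (auto intro: generate.incl)
      moreover have "\<rho> (f (s x)) = x" using s[OF x] calculation by (simp add: \<rho>_def gf)
      ultimately show "x \<in> \<rho> ` carrier L" by (force simp: L_def)
    qed
  qed
  have Hcent: "h \<in> center K" if h: "h \<in> H" and c: "\<And>k. k \<in> H \<Longrightarrow> h \<otimes>\<^bsub>K\<^esub> k = k \<otimes>\<^bsub>K\<^esub> h" for h
  proof -
    have hK: "h \<in> carrier K" using h by simp
    have "h \<otimes>\<^bsub>K\<^esub> x = x \<otimes>\<^bsub>K\<^esub> h" if x: "x \<in> carrier K" for x
    proof -
      define k where "k = s (\<pi> x)"
      have k: "k \<in> carrier K" "\<pi> k = \<pi> x" using s[of "\<pi> x"] x by (auto simp: k_def)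
      have kH: "k \<in> H" using x by (auto simp: k_def H_def intro: generate.incl)
      define z where "z = inv\<^bsub>K\<^esub> k \<otimes>\<^bsub>K\<^esub> x"
      have zK: "z \<in> carrier K" using x k by (simp add: z_def)
      have "\<pi> z = \<one>\<^bsub>G\<^esub>" using x k by (simp add: z_def)
      then have z: "z \<in> center K" using \<pi>ker[OF zK] by simp
      have xkz: "x = k \<otimes>\<^bsub>K\<^esub> z" using x k by (simp add: z_def K.m_assoc[symmetric])
      have "h \<otimes>\<^bsub>K\<^esub> (k \<otimes>\<^bsub>K\<^esub> z) = (k \<otimes>\<^bsub>K\<^esub> h) \<otimes>\<^bsub>K\<^esub> z"
        using c[OF kH] hK k zK by (simp add: K.m_assoc[symmetric])
      also have "\<dots> = k \<otimes>\<^bsub>K\<^esub> (z \<otimes>\<^bsub>K\<^esub> h)"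
        using comm[OF z hK] hK k zK by (simp add: K.m_assoc)
      finally show ?thesis using hK k zK by (simp add: xkz K.m_assoc)
    qed
    then show ?thesis using hK unfolding center_def by blast
  qed
  have ker: "kernel L G \<rho> = center L"
  proof (intro equalityI subsetI)
    fix u assume "u \<in> kernel L G \<rho>"
    then obtain h where h: "h \<in> H" "u = f h" "\<pi> h = \<one>\<^bsub>G\<^esub>"
      by (auto simp: kernel_def L_def \<rho>_def gf)
    then have "h \<in> center K" using \<pi>ker by auto
    then have hk: "h \<otimes>\<^bsub>K\<^esub> k = k \<otimes>\<^bsub>K\<^esub> h" if "k \<in> H" for k using that comm H.mem_carrier by blast
    have "u \<otimes>\<^bsub>L\<^esub> v = v \<otimes>\<^bsub>L\<^esub> u" if "v \<in> carrier L" for v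
    proof -
      obtain k where k: "k \<in> H" "v = f k" using \<open>v \<in> carrier L\<close> by (auto simp: L_def)
      show ?thesis using hk[OF k(1)] h(1) k by (simp add: h(2) L_def gf)
    qed
    moreover have "u \<in> carrier L" using h by (simp add: L_def)
    ultimately show "u \<in> center L" unfolding center_def by blast
  next
    fix u assume u: "u \<in> center L"
    then obtain h where h: "h \<in> H" "u = f h" unfolding center_def L_def by auto
    have "h \<otimes>\<^bsub>K\<^esub> k = k \<otimes>\<^bsub>K\<^esub> h" if k: "k \<in> H" for k
    proof -
      have "f k \<in> carrier L" using k by (simp add: L_def)
      then have "u \<otimes>\<^bsub>L\<^esub> f k = f k \<otimes>\<^bsub>L\<^esub> u" using u unfolding center_def by blast
      then have "f (h \<otimes>\<^bsub>K\<^esub> k) = f (k \<otimes>\<^bsub>K\<^esub> h)" using h k by (simp add: L_def gf)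
      then show ?thesis using finj h k by (auto simp: inj_on_def)
    qed
    then have "h \<in> center K" using Hcent h by blast
    then show "u \<in> kernel L G \<rho>" using h \<pi>ker by (auto simp: kernel_def L_def \<rho>_def gf)
  qed
  have "L Mod center L \<cong> G"
    using \<rho>.FactGroup_iso[OF \<rho>img] by (simp add: ker)
  moreover have "group (L Mod center L)"
    using normal.factorgroup_is_group[OF \<rho>.normal_kernel] by (simp add: ker)
  ultimately have "G \<cong> L Mod center L" by (metis group.iso_sym)
  with Lgrp show ?thesis unfolding capable_def by blast
qed

end

theory Submission
  imports Defs "HOL-Computational_Algebra.Polynomial" "HOL-Library.Countable"
begin

text \<open>
  Let \<open>\<zeta>\<close> be a primitive \<open>p\<close>-th root of unity and \<open>X = \<zeta> - 1\<close>. The group of class \<open>n\<close> is the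
  semidirect product of the additive group of \<open>\<int>[\<zeta>] / (X ^ n)\<close> with a cyclic group of order \<open>p\<close>
  whose generator, the rotation, acts by multiplication with \<open>\<zeta>\<close>; for \<open>p = 2\<close> this is the dihedral
  group of order \<open>2 ^ (n + 1)\<close>.

  Commutation with the rotation is multiplication by \<open>\<zeta> - 1 = X\<close>, up to sign and a unit. So the lower central
  series is the filtration by powers of \<open>X\<close> and has length exactly \<open>n\<close> (\<open>lower_central_eq\<close>), and
  the centre for the parameter \<open>n + 1\<close> is the part killed by \<open>X\<close>, that is \<open>(X ^ n)\<close>; dividing by
  it gives the group for \<open>n\<close> (\<open>capable\<close>). This is where capability comes from.

  The rotation has order \<open>p\<close>, and together with the translation by \<open>1\<close> generates
  everything because the conjugates of the latter are the translations by powers of \<open>\<zeta>\<close>.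
  The order of the translation by \<open>1\<close> is the additive order of \<open>1\<close> modulo \<open>X ^
  n\<close>. As \<open>p\<close> is totally ramified, equal to a unit times \<open>X ^ (p - 1)\<close>, the
  power \<open>p ^ k\<close> vanishes there exactly when \<open>n \<le> k * (p - 1)\<close>
  (\<open>p_power_in_trunc_ideal_iff\<close>), and the least such \<open>k\<close> is \<open>1 + (n - 1) div
  (p - 1)\<close>.

  The ring \<open>\<int>[\<zeta>] / (X ^ n)\<close> is represented by integer polynomials in \<open>X\<close> modulo the ideal
  \<open>trunc_ideal p n\<close> generated by \<open>\<Phi> p = ((1 + X) ^ p - 1) / X\<close> and \<open>X ^ n\<close>. All nonvanishing
  statements reduce to the constant term of \<open>\<Phi> p\<close> being \<open>p\<close>
  (\<open>X_times_in_trunc_ideal_iff\<close>).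
\<close>

section \<open>The truncated cyclotomic ideal\<close>

definition X :: "int poly" where "X = [:0, 1:]"

definition \<zeta> :: "int poly" where "\<zeta> = 1 + X"

lemma poly_X [simp]: "poly X a = a"
  by (simp add: X_def)

lemma poly_\<zeta> [simp]: "poly \<zeta> a = 1 + a"
  by (simp add: \<zeta>_def)

lemma X_neq_0 [simp]: "X \<noteq> 0"
  by (simp add: X_def)

lemma X_dvd_iff: "X dvd f \<longleftrightarrow> poly f 0 = 0"
  by (simp add: X_def poly_eq_0_iff_dvd)

text \<open>The \<open>p\<close>-th cyclotomic polynomial for prime \<open>p\<close>, rewritten in the variable \<open>X = \<zeta> - 1\<close>. Modulo
  it, \<open>\<zeta>\<close> is a primitive \<open>p\<close>-th root of unity and \<open>X\<close> generates the prime above \<open>p\<close>.\<close>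

definition \<Phi> :: "nat \<Rightarrow> int poly" where "\<Phi> p = (\<Sum>i<p. \<zeta> ^ i)"

definition trunc_ideal :: "nat \<Rightarrow> nat \<Rightarrow> int poly set"
  where "trunc_ideal p n = {\<Phi> p * u + X ^ n * v | u v. True}"

lemma trunc_idealI: "\<Phi> p * u + X ^ n * v \<in> trunc_ideal p n"
  unfolding trunc_ideal_def by blast

lemma trunc_ideal_add:
  assumes "f \<in> trunc_ideal p n" "g \<in> trunc_ideal p n" shows "f + g \<in> trunc_ideal p n"
proof -
  obtain u v u' v' where "f = \<Phi> p * u + X ^ n * v" "g = \<Phi> p * u' + X ^ n * v'"
    using assms unfolding trunc_ideal_def by blast
  then have "f + g = \<Phi> p * (u + u') + X ^ n * (v + v')" by (simp add: algebra_simps)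
  then show ?thesis using trunc_idealI by metis
qed

lemma trunc_ideal_mult_ideal:
  assumes "f \<in> trunc_ideal p m" "g \<in> trunc_ideal p n" shows "f * g \<in> trunc_ideal p (m + n)"
proof -
  obtain u v u' v' where "f = \<Phi> p * u + X ^ m * v" "g = \<Phi> p * u' + X ^ n * v'"
    using assms unfolding trunc_ideal_def by blast
  then have "f * g = \<Phi> p * (u * g + X ^ m * v * u') + X ^ (m + n) * (v * v')"
    by (simp only: algebra_simps power_add)
  then show ?thesis using trunc_idealI by metis
qed

lemma in_trunc_ideal_0: "f \<in> trunc_ideal p 0"
  using trunc_idealI[of p 0 0 f] by simp

lemma trunc_ideal_mult: "f \<in> trunc_ideal p n \<Longrightarrow> g * f \<in> trunc_ideal p n"
  using trunc_ideal_mult_ideal[OF in_trunc_ideal_0, of f p n g] by simp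

lemma trunc_ideal_uminus: "f \<in> trunc_ideal p n \<Longrightarrow> - f \<in> trunc_ideal p n"
  using trunc_ideal_mult[of f p n "-1"] by simp

lemma trunc_ideal_diff:
  "f \<in> trunc_ideal p n \<Longrightarrow> g \<in> trunc_ideal p n \<Longrightarrow> f - g \<in> trunc_ideal p n"
  using trunc_ideal_add[of f p n "- g"] trunc_ideal_uminus by simp

lemma zero_in_trunc_ideal: "0 \<in> trunc_ideal p n"
  using trunc_idealI[of p 0 n 0] by simp

lemma trunc_ideal_dvd: "\<Phi> p dvd f \<Longrightarrow> f \<in> trunc_ideal p n"
  using trunc_idealI[of p _ n 0] by (auto simp: dvd_def)

lemma X_power_in_trunc_ideal:
  assumes "n \<le> m" shows "X ^ m * f \<in> trunc_ideal p n"
  using trunc_idealI[of p 0 n "X ^ (m - n) * f"] assms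
  by (simp add: mult.assoc[symmetric] power_add[symmetric])

lemma trunc_ideal_antimono:
  assumes "n \<le> m" "f \<in> trunc_ideal p m" shows "f \<in> trunc_ideal p n"
  using assms trunc_ideal_add[OF trunc_ideal_dvd X_power_in_trunc_ideal[OF assms(1)]]
  by (auto simp: trunc_ideal_def)

lemma X_times_\<Phi>: "X * \<Phi> p = \<zeta> ^ p - 1"
proof -
  have "\<zeta> - 1 = X" by (simp add: \<zeta>_def)
  then show ?thesis unfolding \<Phi>_def by (simp only: power_diff_1_eq)
qed

lemma X_dvd_\<zeta>_power_minus_1: "X dvd \<zeta> ^ m - 1"
  by (simp add: X_dvd_iff)

lemma poly_\<Phi>_0: "poly (\<Phi> p) 0 = int p"
  by (simp add: \<Phi>_def poly_sum)

lemma \<zeta>_power_mod: "\<zeta> ^ i - \<zeta> ^ (i mod p) \<in> trunc_ideal p n"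
proof -
  have "\<Phi> p dvd \<zeta> ^ p - 1" using X_times_\<Phi>[of p] by (metis dvd_triv_right)
  also have "\<dots> dvd (\<zeta> ^ p) ^ (i div p) - 1"
    by (metis power_diff_1_eq dvd_triv_left)
  also have "\<dots> dvd \<zeta> ^ (i mod p) * ((\<zeta> ^ p) ^ (i div p) - 1)" by simp
  also have "\<dots> = \<zeta> ^ i - \<zeta> ^ (i mod p)"
    by (simp only: right_diff_distrib power_mult[symmetric] power_add[symmetric]) simp
  finally show ?thesis by (rule trunc_ideal_dvd)
qed

lemma \<zeta>_power_cong:
  assumes "i mod p = j mod p" shows "\<zeta> ^ i - \<zeta> ^ j \<in> trunc_ideal p n"
  using trunc_ideal_diff[OF \<zeta>_power_mod[of i p n] \<zeta>_power_mod[of j p n]] assms by simp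

text \<open>Multiplication by \<open>X\<close> is injective from one truncation to the next, since
  \<open>X\<close> is prime in \<open>\<int>[X]\<close> and does not divide \<open>\<Phi> p\<close>, whose constant term is \<open>p\<close>. Every negative
  statement below (nontriviality of the last layer, exactness of orders, the bound on the centre)
  comes from this fact.\<close>

lemma X_times_in_trunc_ideal_iff:
  assumes "p > 0"
  shows "X * f \<in> trunc_ideal p (Suc n) \<longleftrightarrow> f \<in> trunc_ideal p n"
proof
  assume "f \<in> trunc_ideal p n"
  then show "X * f \<in> trunc_ideal p (Suc n)"
    using trunc_ideal_mult_ideal[of X p 1 f n] X_power_in_trunc_ideal[of 1 1 1 p] by simp
next
  assume "X * f \<in> trunc_ideal p (Suc n)"
  then obtain u v where uv: "X * f = \<Phi> p * u + X ^ Suc n * v"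
    unfolding trunc_ideal_def by blast
  then have "poly (X * f) 0 = poly (\<Phi> p * u + X ^ Suc n * v) 0" by (rule arg_cong)
  then have "poly u 0 = 0" using assms by (simp add: poly_\<Phi>_0)
  then obtain u' where "u = X * u'" by (auto simp: dvd_def simp flip: X_dvd_iff)
  with uv have "X * f = X * (\<Phi> p * u' + X ^ n * v)" by (simp only: algebra_simps power_Suc)
  then have "f = \<Phi> p * u' + X ^ n * v" unfolding mult_cancel_left by simp
  then show "f \<in> trunc_ideal p n" using trunc_idealI by metis
qed

lemma X_power_times_in_trunc_ideal_iff:
  assumes "p > 0"
  shows "X ^ m * f \<in> trunc_ideal p (m + n) \<longleftrightarrow> f \<in> trunc_ideal p n"
proof (induction m)
  case (Suc m)
  then show ?case using X_times_in_trunc_ideal_iff[OF assms, of "X ^ m * f" "m + n"]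
    by (simp only: power_Suc mult.assoc add_Suc)
qed simp

lemma const_in_trunc_ideal_1:
  assumes "f \<in> trunc_ideal p 1" shows "int p dvd poly f 0"
  using assms by (auto simp: trunc_ideal_def poly_\<Phi>_0)

lemma X_power_notin_trunc_ideal:
  assumes "p > 1" "m < n" shows "X ^ m \<notin> trunc_ideal p n"
proof
  assume "X ^ m \<in> trunc_ideal p n"
  then have "X ^ m * 1 \<in> trunc_ideal p (m + 1)"
    using trunc_ideal_antimono[of "m + 1" n] assms by simp
  then have "1 \<in> trunc_ideal p 1" using assms by (simp only: X_power_times_in_trunc_ideal_iff)
  then have "int p dvd 1" using const_in_trunc_ideal_1 by fastforce
  then show False using assms by simp
qed

text \<open>Since \<open>\<zeta> ^ i - 1 = X * \<Phi> i\<close> and \<open>\<Phi> i\<close> has constant term \<open>i\<close>, the action of \<open>\<zeta> ^ i\<close> is already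
  visible modulo \<open>X\<^sup>2\<close>.\<close>

lemma \<zeta>_power_faithful:
  assumes "p > 0" "n \<ge> 2" "\<zeta> ^ i - 1 \<in> trunc_ideal p n"
  shows "p dvd i"
proof -
  have "\<zeta> ^ i - 1 = X * \<Phi> i" by (simp only: X_times_\<Phi>)
  then have "X * \<Phi> i \<in> trunc_ideal p (Suc 1)"
    using assms trunc_ideal_antimono[of "Suc 1" n] by simp
  then have "\<Phi> i \<in> trunc_ideal p 1" using assms by (simp only: X_times_in_trunc_ideal_iff)
  then show ?thesis using const_in_trunc_ideal_1 by (fastforce simp: poly_\<Phi>_0)
qed

text \<open>The Eisenstein shape of \<open>\<Phi> p\<close>: the inner binomial coefficients are divisible by \<open>p\<close>, and the
  constant term is exactly \<open>p\<close>.\<close>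

lemma \<Phi>_prime:
  assumes "Factorial_Ring.prime p"
  obtains g where "\<Phi> p = X ^ (p - 1) + of_nat p * g" "poly g 0 = 1"
proof -
  have p1: "p > 1" using assms by (rule prime_gt_1_nat)
  define g where "g = (\<Sum>k\<in>{1..<p}. of_nat ((p choose k) div p) * X ^ (k - 1))"
  have "\<zeta> ^ p = (\<Sum>k\<le>p. of_nat (p choose k) * X ^ k)"
    using binomial_ring[of X 1 p] by (simp add: \<zeta>_def add.commute)
  also have "{..p} = insert 0 (insert p {1..<p})" by auto
  also have "(\<Sum>k\<in>insert 0 (insert p {1..<p}). of_nat (p choose k) * X ^ k)
      = 1 + X ^ p + (\<Sum>k\<in>{1..<p}. of_nat (p choose k) * X ^ k)"
    using p1 by simp
  also have "(\<Sum>k\<in>{1..<p}. of_nat (p choose k) * X ^ k) = X * (of_nat p * g)"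
    unfolding g_def sum_distrib_left
  proof (rule sum.cong[OF refl])
    fix k assume k: "k \<in> {1..<p}"
    then have "p dvd (p choose k)" using assms by (intro dvd_choose_prime) auto
    then have 1: "p choose k = p * ((p choose k) div p)" by simp
    have 2: "X ^ k = X * X ^ (k - 1)" using k by (simp flip: power_Suc)
    show "of_nat (p choose k) * X ^ k
        = X * (of_nat p * (of_nat ((p choose k) div p) * X ^ (k - 1)))"
      unfolding 2 by (subst 1) (simp only: of_nat_mult ac_simps)
  qed
  also have "X ^ p = X * X ^ (p - 1)" using p1 by (simp flip: power_Suc)
  finally have "X * \<Phi> p = X * (X ^ (p - 1) + of_nat p * g)"
    unfolding X_times_\<Phi> by (simp add: distrib_left)
  then have g: "\<Phi> p = X ^ (p - 1) + of_nat p * g" unfolding mult_cancel_left by simp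
  then have "poly (\<Phi> p) 0 = poly (X ^ (p - 1) + of_nat p * g) 0" by (rule arg_cong)
  then have "int p = int p * poly g 0" using p1 by (simp add: poly_\<Phi>_0 zero_power)
  then have "poly g 0 = 1" using p1 by simp
  with g that show ?thesis by blast
qed

text \<open>Total ramification, one half. With \<open>g = 1 + X * h\<close> the Eisenstein shape reads
  \<open>p = \<Phi> p - X ^ (p - 1) - h * X * p\<close>, so each membership of \<open>p\<close> feeds back to give one more power
  of \<open>X\<close>, until \<open>X ^ (p - 1)\<close> stops the gain.\<close>

lemma p_in_trunc_ideal:
  assumes "Factorial_Ring.prime p"
  shows "of_nat p \<in> trunc_ideal p (p - 1)"
proof -
  obtain g where g: "\<Phi> p = X ^ (p - 1) + of_nat p * g" "poly g 0 = 1"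
    using \<Phi>_prime[OF assms] .
  have "X dvd g - 1" using g(2) by (simp add: X_dvd_iff)
  then obtain h where h: "g - 1 = X * h" by (rule dvdE)
  then have "g = 1 + X * h" by (metis add.commute diff_add_cancel)
  with g have eq: "(of_nat p :: int poly) = \<Phi> p * 1 + (- 1) * (X ^ (p - 1) * 1) + (- h) * (X * of_nat p)"
    by (simp only: algebra_simps)
  have "j \<le> p - 1 \<Longrightarrow> of_nat p \<in> trunc_ideal p j" for j
  proof (induction j)
    case 0 show ?case by (rule in_trunc_ideal_0)
  next
    case (Suc j)
    then have Xp: "X * of_nat p \<in> trunc_ideal p (Suc j)"
      using trunc_ideal_mult_ideal[of X p 1 "of_nat p" j] X_power_in_trunc_ideal[of 1 1 1 p] by simp
    have "\<Phi> p * 1 + (- 1) * (X ^ (p - 1) * 1) + (- h) * (X * of_nat p) \<in> trunc_ideal p (Suc j)"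
      by (rule trunc_ideal_add[OF trunc_ideal_add[OF trunc_ideal_dvd[OF dvd_triv_left]
            trunc_ideal_mult[OF X_power_in_trunc_ideal[OF Suc.prems]]] trunc_ideal_mult[OF Xp]])
    then show ?case unfolding eq[symmetric] .
  qed
  then show ?thesis by simp
qed

text \<open>Total ramification: \<open>p\<close> behaves like \<open>X ^ (p - 1)\<close> up to a unit. This is the source of the
  denominator \<open>p - 1\<close> in the exponent of the second generator. For the converse, modulo \<open>\<Phi> p\<close>
  the power \<open>X ^ (k * (p - 1))\<close> is a multiple of \<open>p ^ k\<close>.\<close>

lemma p_power_in_trunc_ideal_iff:
  assumes "Factorial_Ring.prime p"
  shows "of_nat (p ^ k) \<in> trunc_ideal p n \<longleftrightarrow> n \<le> k * (p - 1)"
proof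
  assume n: "n \<le> k * (p - 1)"
  have "of_nat (p ^ k) \<in> trunc_ideal p (k * (p - 1))"
  proof (induction k)
    case 0 then show ?case by (simp add: in_trunc_ideal_0)
  next
    case (Suc k)
    then show ?case using trunc_ideal_mult_ideal[OF p_in_trunc_ideal[OF assms] Suc.IH] by simp
  qed
  then show "of_nat (p ^ k) \<in> trunc_ideal p n" using n trunc_ideal_antimono by blast
next
  assume pk: "of_nat (p ^ k) \<in> trunc_ideal p n"
  obtain g where g: "\<Phi> p = X ^ (p - 1) + of_nat p * g" using \<Phi>_prime[OF assms] .
  have "X ^ (p - 1) - (- of_nat p * g) dvd (X ^ (p - 1)) ^ k - (- of_nat p * g) ^ k"
    by (simp only: power_diff_sumr2 dvd_triv_left)
  then have "\<Phi> p dvd (X ^ (p - 1)) ^ k - (- of_nat p * g) ^ k" using g by simp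
  then have 1: "(X ^ (p - 1)) ^ k - (- of_nat p * g) ^ k \<in> trunc_ideal p n"
    by (rule trunc_ideal_dvd)
  have "(- of_nat p * g) ^ k = (- g) ^ k * of_nat (p ^ k)"
    by (simp only: power_mult_distrib[symmetric] of_nat_power) (simp add: mult.commute)
  also have "\<dots> \<in> trunc_ideal p n" using pk by (rule trunc_ideal_mult)
  finally have "X ^ (k * (p - 1)) \<in> trunc_ideal p n"
    using trunc_ideal_add[OF 1] unfolding mult.commute[of k] power_mult by fastforce
  then show "n \<le> k * (p - 1)"
    using X_power_notin_trunc_ideal[OF prime_gt_1_nat[OF assms]] not_less by blast
qed

section \<open>The semidirect product with the cyclic group of order p\<close>

text \<open>The semidirect product law on representatives. Exponents of the rotation are natural numbers,
  so this is only a monoid; inverses appear after passing to the quotient by \<open>cong_pair\<close>.\<close>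

definition twist :: "int poly \<times> nat \<Rightarrow> int poly \<times> nat \<Rightarrow> int poly \<times> nat"
  where "twist a b = (fst a + \<zeta> ^ snd a * fst b, snd a + snd b)"

definition cong_pair :: "nat \<Rightarrow> nat \<Rightarrow> int poly \<times> nat \<Rightarrow> int poly \<times> nat \<Rightarrow> bool"
  where "cong_pair p n a b \<longleftrightarrow> fst a - fst b \<in> trunc_ideal p n \<and> snd a mod p = snd b mod p"

lemma equivp_cong_pair: "equivp (cong_pair p n)"
proof (rule equivpI)
  show "reflp (cong_pair p n)" by (rule reflpI) (simp add: cong_pair_def zero_in_trunc_ideal)
  show "symp (cong_pair p n)"
    by (rule sympI) (use trunc_ideal_uminus in \<open>fastforce simp: cong_pair_def\<close>)
  show "transp (cong_pair p n)"
    by (rule transpI) (use trunc_ideal_add in \<open>fastforce simp: cong_pair_def\<close>)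
qed

lemma cong_pair_twist:
  assumes "cong_pair p n a a'" "cong_pair p n b b'" shows "cong_pair p n (twist a b) (twist a' b')"
proof -
  have "(fst a + \<zeta> ^ snd a * fst b) - (fst a' + \<zeta> ^ snd a' * fst b')
      = (fst a - fst a') + \<zeta> ^ snd a * (fst b - fst b') + fst b' * (\<zeta> ^ snd a - \<zeta> ^ snd a')"
    by (simp add: algebra_simps)
  also have "\<dots> \<in> trunc_ideal p n"
    using assms by (intro trunc_ideal_add trunc_ideal_mult \<zeta>_power_cong) (auto simp: cong_pair_def)
  finally show ?thesis using assms by (auto simp: cong_pair_def twist_def intro: mod_add_cong)
qed

text \<open>Classes of pairs are named by natural numbers through a chosen representative: the coefficient
  list makes the countable set of integer polynomials available to \<open>to_nat\<close>.\<close>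

definition code :: "nat \<Rightarrow> nat \<Rightarrow> int poly \<times> nat \<Rightarrow> nat"
  where "code p n a = (let r = SOME b. cong_pair p n a b in to_nat (coeffs (fst r), snd r))"

lemma code_eq_iff: "code p n a = code p n b \<longleftrightarrow> cong_pair p n a b"
proof
  assume eq: "code p n a = code p n b"
  have some: "cong_pair p n c (SOME d. cong_pair p n c d)" for c
    by (rule someI[of _ c]) (rule equivp_reflp[OF equivp_cong_pair])
  have "(SOME d. cong_pair p n a d) = (SOME d. cong_pair p n b d)"
    using eq by (auto simp: code_def Let_def coeffs_eq_iff prod_eq_iff)
  with some[of a] some[of b] show "cong_pair p n a b"
    by (metis equivp_symp equivp_transp equivp_cong_pair)
next
  assume "cong_pair p n a b"
  then have "cong_pair p n a = cong_pair p n b" using equivp_cong_pair by (metis equivp_def)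
  then show "code p n a = code p n b" by (simp add: code_def)
qed

definition decode :: "nat \<Rightarrow> nat \<Rightarrow> nat \<Rightarrow> int poly \<times> nat"
  where "decode p n = inv_into UNIV (code p n)"

lemma code_decode: "u \<in> range (code p n) \<Longrightarrow> code p n (decode p n u) = u"
  by (simp add: decode_def f_inv_into_f)

definition cyc_group :: "nat \<Rightarrow> nat \<Rightarrow> nat monoid"
  where "cyc_group p n = \<lparr>carrier = range (code p n),
    monoid.mult = (\<lambda>u v. code p n (twist (decode p n u) (decode p n v))),
    one = code p n (0, 0)\<rparr>"

locale cyclotomic_group =
  fixes p n :: nat
  assumes prime: "Factorial_Ring.prime p" and n_pos: "n > 0"
begin

abbreviation G :: "nat monoid" where "G \<equiv> cyc_group p n"

definition E :: "int poly \<Rightarrow> nat \<Rightarrow> nat" where "E f i = code p n (f, i)"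

lemma p_gt_1: "p > 1" using prime by (rule prime_gt_1_nat)

lemma carrier_iff: "u \<in> carrier G \<longleftrightarrow> (\<exists>f i. u = E f i)"
  by (auto simp: cyc_group_def E_def)

lemma E_closed [simp]: "E f i \<in> carrier G"
  using carrier_iff by blast

lemma E_eq_iff: "E f i = E g j \<longleftrightarrow> f - g \<in> trunc_ideal p n \<and> i mod p = j mod p"
  by (simp add: E_def code_eq_iff cong_pair_def)

lemma E_mult [simp]: "E f i \<otimes>\<^bsub>G\<^esub> E g j = E (f + \<zeta> ^ i * g) (i + j)"
proof -
  have "cong_pair p n (decode p n (code p n a)) a" for a
    by (simp add: code_eq_iff[symmetric] code_decode)
  then have "code p n (twist (decode p n (E f i)) (decode p n (E g j))) = code p n (twist (f, i) (g, j))"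
    unfolding code_eq_iff E_def by (intro cong_pair_twist)
  then show ?thesis by (simp add: cyc_group_def twist_def E_def)
qed

lemma E_one: "\<one>\<^bsub>G\<^esub> = E 0 0"
  by (simp add: cyc_group_def E_def)

sublocale group G
proof (rule groupI)
  fix u assume "u \<in> carrier G"
  then obtain f i where u: "u = E f i" by (auto simp: carrier_iff)
  have "E (- (\<zeta> ^ ((p - 1) * i) * f)) ((p - 1) * i) \<otimes>\<^bsub>G\<^esub> u = E 0 (p * i)"
    using p_gt_1 by (simp add: u algebra_simps)
  also have "\<dots> = \<one>\<^bsub>G\<^esub>" by (simp add: E_one E_eq_iff zero_in_trunc_ideal)
  finally show "\<exists>v\<in>carrier G. v \<otimes>\<^bsub>G\<^esub> u = \<one>\<^bsub>G\<^esub>" by (rule bexI) (rule E_closed)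
next
  fix u v w assume "u \<in> carrier G" "v \<in> carrier G" "w \<in> carrier G"
  then obtain f i g j h k where "u = E f i" "v = E g j" "w = E h k" by (auto simp: carrier_iff)
  then show "u \<otimes>\<^bsub>G\<^esub> v \<otimes>\<^bsub>G\<^esub> w = u \<otimes>\<^bsub>G\<^esub> (v \<otimes>\<^bsub>G\<^esub> w)"
    by (simp add: algebra_simps power_add)
next
  fix u v assume "u \<in> carrier G" "v \<in> carrier G"
  then obtain f i g j where "u = E f i" "v = E g j" by (auto simp: carrier_iff)
  then show "u \<otimes>\<^bsub>G\<^esub> v \<in> carrier G" by simp
qed (auto simp: carrier_iff E_one)

lemma E_inv: "inv\<^bsub>G\<^esub> E f i = E (- (\<zeta> ^ ((p - 1) * i) * f)) ((p - 1) * i)"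
proof (rule inv_equality)
  have "E (- (\<zeta> ^ ((p - 1) * i) * f)) ((p - 1) * i) \<otimes>\<^bsub>G\<^esub> E f i = E 0 (p * i)"
    using p_gt_1 by (simp add: algebra_simps)
  also have "\<dots> = \<one>\<^bsub>G\<^esub>" by (simp add: E_one E_eq_iff zero_in_trunc_ideal)
  finally show "E (- (\<zeta> ^ ((p - 1) * i) * f)) ((p - 1) * i) \<otimes>\<^bsub>G\<^esub> E f i = \<one>\<^bsub>G\<^esub>" .
qed auto

lemma E_inv_0 [simp]: "inv\<^bsub>G\<^esub> E f 0 = E (- f) 0"
  by (simp add: E_inv)

section \<open>Orders of elements and generation\<close>

lemma E_pow_0: "E f 0 [^]\<^bsub>G\<^esub> (m :: nat) = E (of_nat m * f) 0"
  by (induction m) (simp_all add: E_one algebra_simps)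

lemma E_pow: "\<exists>g. E f i [^]\<^bsub>G\<^esub> (m :: nat) = E g (m * i)"
  by (induction m) (auto simp: E_one algebra_simps)

lemma E_rotation_pow: "E 0 1 [^]\<^bsub>G\<^esub> (m :: nat) = E 0 m"
  by (induction m) (simp_all add: E_one)

text \<open>The least \<open>k\<close> with \<open>n \<le> k * (p - 1)\<close>.\<close>

definition translation_exp :: nat where "translation_exp = 1 + (n - 1) div (p - 1)"

lemma p_power_translation_exp: "of_nat (p ^ translation_exp) \<in> trunc_ideal p n"
proof -
  have "n - 1 < (p - 1) * translation_exp"
    using dividend_less_times_div[of "p - 1" "n - 1"] p_gt_1 by (simp add: translation_exp_def algebra_simps)
  then show ?thesis
    unfolding p_power_in_trunc_ideal_iff[OF prime] by (simp add: mult.commute)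
qed

lemma p_power_below_translation_exp: "of_nat (p ^ (translation_exp - 1)) \<notin> trunc_ideal p n"
proof -
  have "(translation_exp - 1) * (p - 1) \<le> n - 1" unfolding translation_exp_def by simp
  then show ?thesis using p_power_in_trunc_ideal_iff[OF prime, of "translation_exp - 1" n] n_pos by linarith
qed

text \<open>A \<open>p\<close>-th power has trivial rotation part, and a translation is killed by a power of \<open>p\<close>.\<close>

lemma p_group: "p_group p G"
  unfolding p_group_def
proof (intro conjI ballI is_group)
  fix u assume "u \<in> carrier G"
  then obtain f i where u: "u = E f i" by (auto simp: carrier_iff)
  obtain g where "u [^]\<^bsub>G\<^esub> p = E g (p * i)" using E_pow u by blast
  also have "\<dots> = E g 0" by (simp add: E_eq_iff zero_in_trunc_ideal)
  finally have "u [^]\<^bsub>G\<^esub> (p * p ^ translation_exp) = E (of_nat (p ^ translation_exp) * g) 0"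
    using u by (simp add: nat_pow_pow[symmetric] E_pow_0)
  also have "\<dots> = \<one>\<^bsub>G\<^esub>"
    using trunc_ideal_mult[OF p_power_translation_exp, of g] by (simp add: E_one E_eq_iff mult.commute)
  finally have "group.ord G u dvd p ^ Suc translation_exp" using u by (simp add: pow_eq_id)
  then show "\<exists>k. group.ord G u = p ^ k"
    using divides_primepow_nat[OF prime] by blast
qed

lemma ord_rotation: "group.ord G (E 0 1) = p"
proof -
  have "E 0 1 [^]\<^bsub>G\<^esub> p = \<one>\<^bsub>G\<^esub>"
    unfolding E_rotation_pow by (simp add: E_one E_eq_iff zero_in_trunc_ideal)
  then have "group.ord G (E 0 1) dvd p" by (simp add: pow_eq_id)
  moreover have "E 0 1 \<noteq> \<one>\<^bsub>G\<^esub>" using p_gt_1 by (simp add: E_one E_eq_iff)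
  then have "group.ord G (E 0 1) \<noteq> 1"
    using ord_eq_1 E_closed by blast
  ultimately show ?thesis using prime by (auto simp: prime_nat_iff)
qed

lemma ord_translation: "group.ord G (E 1 0) = p ^ translation_exp"
proof -
  have iff: "group.ord G (E 1 0) dvd p ^ k \<longleftrightarrow> of_nat (p ^ k) \<in> trunc_ideal p n" for k
    by (simp add: pow_eq_id[symmetric] E_pow_0 E_one E_eq_iff del: of_nat_power)
  then obtain k where k: "k \<le> translation_exp" "group.ord G (E 1 0) = p ^ k"
    using p_power_translation_exp prime by (metis divides_primepow_nat)
  have "\<not> k \<le> translation_exp - 1" using iff[of "translation_exp - 1"] p_power_below_translation_exp k(2) le_imp_power_dvd by metis
  then have "k = translation_exp" using k(1) by simp
  then show ?thesis using k by simp
qed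

lemma one_notin_trunc_ideal: "1 \<notin> trunc_ideal p n"
  using X_power_notin_trunc_ideal[of p 0 n] p_gt_1 n_pos by simp

text \<open>The image of \<open>X ^ k\<close>; from \<open>k = 1\<close> on, these are the terms of the lower central series.\<close>

definition layer :: "nat \<Rightarrow> nat set" where "layer k = {E (X ^ k * f) 0 | f. True}"

lemma subgroup_layer: "subgroup (layer k) G"
  unfolding layer_def
proof (rule subgroupI)
  fix a assume "a \<in> {E (X ^ k * f) 0 | f. True}"
  then obtain f where "a = E (X ^ k * f) 0" by blast
  then have "inv\<^bsub>G\<^esub> a = E (X ^ k * (- f)) 0" by simp
  then show "inv\<^bsub>G\<^esub> a \<in> {E (X ^ k * f) 0 | f. True}" by blast
next
  fix a b assume "a \<in> {E (X ^ k * f) 0 | f. True}" "b \<in> {E (X ^ k * f) 0 | f. True}"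
  then obtain f g where "a = E (X ^ k * f) 0" "b = E (X ^ k * g) 0" by blast
  then have "a \<otimes>\<^bsub>G\<^esub> b = E (X ^ k * (f + g)) 0" by (simp add: algebra_simps)
  then show "a \<otimes>\<^bsub>G\<^esub> b \<in> {E (X ^ k * f) 0 | f. True}" by blast
qed auto

lemma subgroup_rotations: "subgroup (range (E 0)) G"
  by (rule subgroupI) (auto simp: E_inv)

text \<open>Conjugation by the rotation is multiplication by \<open>\<zeta>\<close>, so the translations reached from
  \<open>E 1 0\<close> are closed under multiplication by \<open>X = \<zeta> - 1\<close>; Horner's scheme then gives all of them.\<close>

lemma generate_rotation_translation: "generate G {E 0 1, E 1 0} = carrier G"
proof
  let ?H = "generate G {E 0 1, E 1 0}"
  have H: "subgroup ?H G" by (rule generate_is_subgroup) auto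
  interpret H: subgroup ?H G by (rule H)
  show "?H \<subseteq> carrier G" by (rule generate_incl) auto
  have a: "E 0 1 \<in> ?H" and b: "E 1 0 \<in> ?H" by (auto intro: generate.incl)
  have rot: "E 0 i \<in> ?H" for i
  proof (induction i)
    case 0 then show ?case using H.one_closed by (simp add: E_one)
  next
    case (Suc i) then show ?case using H.m_closed[OF Suc a] by simp
  qed
  have add: "E (f + g) 0 \<in> ?H" if "E f 0 \<in> ?H" "E g 0 \<in> ?H" for f g
    using H.m_closed[OF that] by simp
  have neg: "E (- f) 0 \<in> ?H" if "E f 0 \<in> ?H" for f
    using H.m_inv_closed[OF that] by simp
  have zeta: "E (\<zeta> * f) 0 \<in> ?H" if "E f 0 \<in> ?H" for f
  proof -
    have "E 0 1 \<otimes>\<^bsub>G\<^esub> E f 0 \<otimes>\<^bsub>G\<^esub> E 0 (p - 1) \<in> ?H"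
      using that a rot by (intro H.m_closed)
    also have "E 0 1 \<otimes>\<^bsub>G\<^esub> E f 0 \<otimes>\<^bsub>G\<^esub> E 0 (p - 1) = E (\<zeta> * f) 0"
      using p_gt_1 by (simp add: E_eq_iff zero_in_trunc_ideal)
    finally show ?thesis .
  qed
  have nat: "E (of_nat m) 0 \<in> ?H" for m
  proof (induction m)
    case 0 then show ?case using rot by simp
  next
    case (Suc m) then show ?case using add[OF b] by simp
  qed
  have int: "E [:c:] 0 \<in> ?H" for c :: int
  proof (cases c rule: int_cases2)
    case (nonneg m)
    then show ?thesis using nat[of m] by (simp add: of_nat_poly)
  next
    case (nonpos m)
    then show ?thesis using neg[OF nat[of m]] by (simp add: of_nat_poly)
  qed
  have poly: "E f 0 \<in> ?H" for f
  proof (induction f)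
    case 0 then show ?case using rot by simp
  next
    case (pCons c f)
    \<comment> \<open>The last two summands add up to \<open>X * f\<close>.\<close>
    have "pCons c f = [:c:] + (\<zeta> * f + - f)" by (simp add: \<zeta>_def X_def distrib_right)
    then show ?case using add[OF int add[OF zeta neg]] pCons.IH by metis
  qed
  show "carrier G \<subseteq> ?H"
  proof
    fix u assume "u \<in> carrier G"
    then obtain f i where "u = E f 0 \<otimes>\<^bsub>G\<^esub> E 0 i" by (auto simp: carrier_iff)
    then show "u \<in> ?H" using H.m_closed[OF poly rot] by simp
  qed
qed

lemma minimally_generated: "minimally_generated_by G {E 0 1, E 1 0}"
  unfolding minimally_generated_by_def
proof (intro conjI allI impI)
  fix T assume T: "T \<subset> {E 0 1, E 1 0}"
  then consider "T \<subseteq> {E 0 1}" | "T \<subseteq> {E 1 0}" by blast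
  then show "generate G T \<noteq> carrier G"
  proof cases
    case 1
    then have "generate G T \<subseteq> range (E 0)"
      by (intro generate_subgroup_incl subgroup_rotations) auto
    moreover have "E 1 0 \<notin> range (E 0)"
      using one_notin_trunc_ideal by (auto simp: E_eq_iff)
    ultimately show ?thesis by (metis E_closed subsetD)
  next
    case 2
    then have "generate G T \<subseteq> layer 0"
      by (intro generate_subgroup_incl subgroup_layer) (auto simp: layer_def)
    moreover have "E 0 1 \<notin> layer 0"
      using p_gt_1 by (auto simp: E_eq_iff layer_def)
    ultimately show ?thesis by (metis E_closed subsetD)
  qed
qed (use generate_rotation_translation in simp_all)

section \<open>The lower central series\<close>

text \<open>Commutation with the inverse of the rotation \<open>E 0 1\<close> is multiplication by \<open>\<zeta> - 1 = X\<close>, so every element of a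
  layer is a single commutator. The representative \<open>p - 1\<close> is used because inversion turns it into
  \<open>(p - 1) * (p - 1)\<close>, which is \<open>1\<close> modulo \<open>p\<close>.\<close>

lemma commutator_layer_rotation:
  "inv\<^bsub>G\<^esub> E (X ^ k * f) 0 \<otimes>\<^bsub>G\<^esub> inv\<^bsub>G\<^esub> E 0 (p - 1) \<otimes>\<^bsub>G\<^esub> E (X ^ k * f) 0 \<otimes>\<^bsub>G\<^esub> E 0 (p - 1)
    = E (X ^ Suc k * f) 0"
proof -
  define q where "q = p - 1"
  have q: "p = Suc q" "p - Suc 0 = q" using p_gt_1 by (auto simp: q_def)
  have sum: "q * q + q = p * q" by (simp add: q(1))
  have "q * q mod p = 1 mod p"
  proof (cases q)
    case (Suc r)
    have "q * q = r * p + 1" by (simp add: Suc q(1))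
    then show ?thesis by (metis mod_mult_self3)
  qed (use q p_gt_1 in simp)
  then have "\<zeta> ^ (q * q) - \<zeta> ^ 1 \<in> trunc_ideal p n" by (rule \<zeta>_power_cong)
  then have "X ^ k * f * (\<zeta> ^ (q * q) - \<zeta> ^ 1) \<in> trunc_ideal p n" by (rule trunc_ideal_mult)
  also have "X ^ k * f * (\<zeta> ^ (q * q) - \<zeta> ^ 1)
      = - (X ^ k * f) + \<zeta> ^ (q * q) * (X ^ k * f) - X ^ Suc k * f"
    by (simp add: \<zeta>_def algebra_simps)
  finally show ?thesis by (simp add: E_inv q(2) E_eq_iff sum)
qed

lemma commutator_layer:
  "\<exists>h. inv\<^bsub>G\<^esub> E (X ^ k * f) 0 \<otimes>\<^bsub>G\<^esub> inv\<^bsub>G\<^esub> E g j \<otimes>\<^bsub>G\<^esub> E (X ^ k * f) 0 \<otimes>\<^bsub>G\<^esub> E g j = E (X ^ Suc k * h) 0"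
proof -
  let ?m = "(p - 1) * j"
  obtain r where r: "\<zeta> ^ ?m - 1 = X * r" using X_dvd_\<zeta>_power_minus_1[of ?m] by (rule dvdE)
  have "inv\<^bsub>G\<^esub> E (X ^ k * f) 0 \<otimes>\<^bsub>G\<^esub> inv\<^bsub>G\<^esub> E g j \<otimes>\<^bsub>G\<^esub> E (X ^ k * f) 0 \<otimes>\<^bsub>G\<^esub> E g j
    = E (X ^ k * f * (\<zeta> ^ ?m - 1)) (p * j)"
    using p_gt_1 by (simp add: E_inv algebra_simps)
  also have "\<dots> = E (X ^ k * f * (\<zeta> ^ ?m - 1)) 0"
    by (simp add: E_eq_iff zero_in_trunc_ideal)
  also have "X ^ k * f * (\<zeta> ^ ?m - 1) = X ^ Suc k * (f * r)"
    unfolding r by (simp only: power_Suc mult_ac)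
  finally show ?thesis by blast
qed

text \<open>Modulo \<open>X\<close> the action is trivial, so the quotient by the first layer is abelian.\<close>

lemma commutator_in_first_layer:
  "\<exists>h. inv\<^bsub>G\<^esub> E f i \<otimes>\<^bsub>G\<^esub> inv\<^bsub>G\<^esub> E g j \<otimes>\<^bsub>G\<^esub> E f i \<otimes>\<^bsub>G\<^esub> E g j = E (X * h) 0"
proof -
  let ?i = "(p - 1) * i" and ?j = "(p - 1) * j"
  define w where "w = - (\<zeta> ^ ?i * f) - \<zeta> ^ (?i + ?j) * g + \<zeta> ^ (?i + ?j) * f + \<zeta> ^ (?i + ?j + i) * g"
  have "X dvd w" by (simp add: X_dvd_iff w_def)
  then obtain h where h: "w = X * h" by (rule dvdE)
  have "inv\<^bsub>G\<^esub> E f i \<otimes>\<^bsub>G\<^esub> inv\<^bsub>G\<^esub> E g j \<otimes>\<^bsub>G\<^esub> E f i \<otimes>\<^bsub>G\<^esub> E g j = E w (?i + ?j + i + j)"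
    by (simp add: E_inv w_def algebra_simps power_add)
  also have "?i + ?j + i + j = p * (i + j)" using p_gt_1 by (cases p) (auto simp: algebra_simps)
  also have "E w (p * (i + j)) = E w 0" by (simp add: E_eq_iff zero_in_trunc_ideal)
  finally show ?thesis using h by blast
qed

lemma commutator_subgroup_eq_layer:
  assumes A: "layer k \<subseteq> A"
    and C: "\<And>a b. a \<in> A \<Longrightarrow> b \<in> carrier G \<Longrightarrow>
      inv\<^bsub>G\<^esub> a \<otimes>\<^bsub>G\<^esub> inv\<^bsub>G\<^esub> b \<otimes>\<^bsub>G\<^esub> a \<otimes>\<^bsub>G\<^esub> b \<in> layer (Suc k)"
  shows "commutator_subgroup G A (carrier G) = layer (Suc k)"
  unfolding commutator_subgroup_def
proof
  let ?C = "{inv\<^bsub>G\<^esub> a \<otimes>\<^bsub>G\<^esub> inv\<^bsub>G\<^esub> b \<otimes>\<^bsub>G\<^esub> a \<otimes>\<^bsub>G\<^esub> b | a b. a \<in> A \<and> b \<in> carrier G}"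
  show "generate G ?C \<subseteq> layer (Suc k)"
    using C by (intro generate_subgroup_incl subgroup_layer) blast
  show "layer (Suc k) \<subseteq> generate G ?C"
  proof
    fix u assume "u \<in> layer (Suc k)"
    then obtain f where u: "u = E (X ^ Suc k * f) 0" unfolding layer_def by blast
    have "E (X ^ k * f) 0 \<in> A" using A by (auto simp: layer_def)
    then have "u \<in> ?C" unfolding u commutator_layer_rotation[symmetric] using E_closed by blast
    then show "u \<in> generate G ?C" by (rule generate.incl)
  qed
qed

lemma lower_central_eq: "lower_central G (Suc (Suc k)) = layer (Suc k)"
proof (induction k)
  case 0
  have "commutator_subgroup G (carrier G) (carrier G) = layer (Suc 0)"
  proof (rule commutator_subgroup_eq_layer)
    fix a b assume "a \<in> carrier G" "b \<in> carrier G"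
    then obtain f i g j where "a = E f i" "b = E g j" by (auto simp: carrier_iff)
    then show "inv\<^bsub>G\<^esub> a \<otimes>\<^bsub>G\<^esub> inv\<^bsub>G\<^esub> b \<otimes>\<^bsub>G\<^esub> a \<otimes>\<^bsub>G\<^esub> b \<in> layer (Suc 0)"
      using commutator_in_first_layer[of f i g j] by (auto simp: layer_def simp del: E_mult)
  qed (auto simp: layer_def)
  then show ?case by simp
next
  case (Suc k)
  have "commutator_subgroup G (layer (Suc k)) (carrier G) = layer (Suc (Suc k))"
  proof (rule commutator_subgroup_eq_layer)
    fix a b assume "a \<in> layer (Suc k)" "b \<in> carrier G"
    then obtain f g j where "a = E (X ^ Suc k * f) 0" "b = E g j"
      by (auto simp: carrier_iff layer_def)
    then show "inv\<^bsub>G\<^esub> a \<otimes>\<^bsub>G\<^esub> inv\<^bsub>G\<^esub> b \<otimes>\<^bsub>G\<^esub> a \<otimes>\<^bsub>G\<^esub> b \<in> layer (Suc (Suc k))"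
      using commutator_layer[of "Suc k" f g j] unfolding layer_def by blast
  qed simp
  with Suc show ?case by simp
qed

lemma class_exactly: "class_exactly G n"
  unfolding class_exactly_def
proof
  have "E (X ^ n * f) 0 = \<one>\<^bsub>G\<^esub>" for f
    by (simp add: E_one E_eq_iff X_power_in_trunc_ideal)
  then have "layer n = {\<one>\<^bsub>G\<^esub>}" by (auto simp: layer_def)
  then show "lower_central G (n + 1) = {\<one>\<^bsub>G\<^esub>}"
    using n_pos lower_central_eq[of "n - 1"] by simp
next
  have "E (X ^ (n - 1) * 1) 0 \<in> lower_central G n"
  proof (cases "n = 1")
    case False
    then obtain k where "n = Suc (Suc k)" using n_pos by (metis One_nat_def gr0_conv_Suc not0_implies_Suc)
    then have "lower_central G n = layer (n - 1)" by (metis lower_central_eq diff_Suc_1)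
    then show ?thesis unfolding layer_def by blast
  next
    case True
    then have "lower_central G n = carrier G" by (metis One_nat_def lower_central.simps(2))
    then show ?thesis using E_closed by blast
  qed
  moreover have "E (X ^ (n - 1) * 1) 0 \<noteq> \<one>\<^bsub>G\<^esub>"
    using X_power_notin_trunc_ideal[OF p_gt_1, of "n - 1" n] n_pos by (simp add: E_one E_eq_iff)
  ultimately show "lower_central G n \<noteq> {\<one>\<^bsub>G\<^esub>}" by blast
qed

section \<open>The centre and capability\<close>

text \<open>The witness is the same construction with truncation \<open>n + 1\<close>. A central element there commutes
  with the rotation, so \<open>X\<close> kills its translation part, which therefore lies in the ideal for \<open>n\<close>;
  it also commutes with \<open>E 1 0\<close>, so \<open>\<zeta>_power_faithful\<close> removes its rotation part. Hence the centre is
  the kernel of the reduction from truncation \<open>n + 1\<close> to \<open>n\<close>.\<close>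

lemma capable: "capable G"
proof -
  interpret K: cyclotomic_group p "Suc n" by unfold_locales (use prime in auto)
  \<comment> \<open>Reduction of representatives; well defined because the ideals decrease in \<open>n\<close>.\<close>
  define \<phi> where "\<phi> u = code p n (decode p (Suc n) u)" for u
  have \<phi>: "\<phi> (K.E f i) = E f i" for f i
  proof -
    have "cong_pair p (Suc n) (decode p (Suc n) (K.E f i)) (f, i)"
      by (simp add: K.E_def code_eq_iff[symmetric] code_decode)
    then have "cong_pair p n (decode p (Suc n) (K.E f i)) (f, i)"
      using trunc_ideal_antimono[of n "Suc n"] by (auto simp: cong_pair_def)
    then show ?thesis by (simp add: \<phi>_def E_def code_eq_iff)
  qed
  interpret \<phi>: group_hom K.G G \<phi>
  proof unfold_locales
    show "\<phi> \<in> hom K.G G" by (rule homI) (auto simp: K.carrier_iff \<phi>)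
  qed
  have "kernel K.G G \<phi> = center K.G"
  proof (intro equalityI subsetI)
    fix u assume "u \<in> kernel K.G G \<phi>"
    then obtain f i where u: "u = K.E f i" "\<phi> u = \<one>\<^bsub>G\<^esub>" by (auto simp: kernel_def K.carrier_iff)
    then have fi: "f \<in> trunc_ideal p n" "i mod p = 0 mod p"
      unfolding \<phi> E_one E_eq_iff u(1) by auto
    then have uf: "u = K.E f 0" by (simp add: u K.E_eq_iff zero_in_trunc_ideal)
    have "u \<otimes>\<^bsub>K.G\<^esub> v = v \<otimes>\<^bsub>K.G\<^esub> u" if v: "v \<in> carrier K.G" for v
    proof -
      obtain g j where v: "v = K.E g j" using v by (auto simp: K.carrier_iff)
      obtain r where r: "\<zeta> ^ j - 1 = X * r" using X_dvd_\<zeta>_power_minus_1[of j] by (rule dvdE)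
      have "(f + g) - (g + \<zeta> ^ j * f) = - ((\<zeta> ^ j - 1) * f)" by (simp add: algebra_simps)
      also have "\<dots> = (- r) * (X * f)" unfolding r by simp
      also have "\<dots> \<in> trunc_ideal p (Suc n)"
        using fi p_gt_1 X_times_in_trunc_ideal_iff[of p f n] by (simp add: trunc_ideal_mult del: mult_minus_left)
      finally show ?thesis by (simp add: uf v K.E_eq_iff)
    qed
    then show "u \<in> center K.G" unfolding center_def uf by simp
  next
    fix u assume u: "u \<in> center K.G"
    then obtain f i where fi: "u = K.E f i" by (auto simp: center_def K.carrier_iff)
    have comm: "K.E f i \<otimes>\<^bsub>K.G\<^esub> K.E g j = K.E g j \<otimes>\<^bsub>K.G\<^esub> K.E f i" for g j
      using u K.E_closed[of g j] unfolding fi center_def by blast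
    have "f - \<zeta> * f \<in> trunc_ideal p (Suc n)" using comm[of 0 1] by (simp add: K.E_eq_iff)
    then have "- (f - \<zeta> * f) \<in> trunc_ideal p (Suc n)" by (rule trunc_ideal_uminus)
    moreover have "- (f - \<zeta> * f) = X * f" by (simp add: \<zeta>_def algebra_simps)
    ultimately have "f \<in> trunc_ideal p n"
      using X_times_in_trunc_ideal_iff[of p f n] p_gt_1 by simp
    moreover have "\<zeta> ^ i - 1 \<in> trunc_ideal p (Suc n)"
      using comm[of 1 0] by (simp add: K.E_eq_iff algebra_simps)
    then have "p dvd i" using \<zeta>_power_faithful[of p "Suc n" i] p_gt_1 n_pos by simp
    ultimately show "u \<in> kernel K.G G \<phi>"
      by (auto simp: kernel_def fi \<phi> E_one E_eq_iff)
  qed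
  moreover have "\<phi> ` carrier K.G = carrier G"
    by (force simp: carrier_iff K.carrier_iff \<phi>)
  then have "K.G Mod kernel K.G G \<phi> \<cong> G" by (rule \<phi>.FactGroup_iso)
  ultimately have "G \<cong> K.G Mod center K.G"
    using normal.factorgroup_is_group[OF \<phi>.normal_kernel] by (metis group.iso_sym)
  then show ?thesis using capableI is_group K.is_group by blast
qed

end

section \<open>Existence of the capable group\<close>

theorem mainTheorem1:
  fixes p c :: nat
  assumes "Factorial_Ring.prime p" and "c > 0"
  shows "\<exists>G :: nat monoid. capable G \<and> p_group p G \<and> class_exactly G c \<and>
    (\<exists>a b. a \<noteq> b \<and> minimally_generated_by G {a, b} \<and>
      group.ord G a = p \<and> group.ord G b = p ^ (1 + (c - 1) div (p - 1)))"
proof -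
  interpret cyclotomic_group p c by unfold_locales (use assms in auto)
  have "E 0 1 \<noteq> E 1 0" using p_gt_1 by (simp add: E_eq_iff)
  then show ?thesis
    using capable p_group class_exactly minimally_generated ord_rotation ord_translation unfolding translation_exp_def by blast
qed

end
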